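(* Every separable Banach space $E$ is isometric to a subspace $Y \subset \ell^\infty$ such that $Y \cap c = \{0\}$.
   Context: The scalar field is $\mathbb{K}=\mathbb{R}$ or $\mathbb{C}$. $\ell^\infty$ is the Banach space of all bounded $\mathbb{K}$-valued sequences $(x_n)_{n=1}^\infty$ with the sup norm $\|\cdot\|_\infty$, and $c\subset\ell^\infty$ is the subspace of convergent sequences. Subspace means linear subspace. "Isometric to a subspace $Y$" means that there is a linear map $T:E\to\ell^\infty$ with $\|T(x)\|_\infty=\|x\|$ for all $x\in E$ and $T(E)=Y$. *)

theory Defs
  imports "HOL-Analysis.Analysis"
begin

text \<open>
  A natural number index carries the discrete topology, so \<^typ>\<open>nat \<Rightarrow>\<^sub>C 'k\<close> is the space of all
  bounded \<open>'k\<close>-valued sequences with the supremum norm. The library only provides its real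
  scalar multiplication; the one over the field \<open>'k\<close> itself is added here.
\<close>

type_synonym 'k linfty = "nat \<Rightarrow>\<^sub>C 'k"

definition scale_linfty :: "'k::real_normed_field \<Rightarrow> 'k linfty \<Rightarrow> 'k linfty" where
  "scale_linfty c f = Bcontfun (\<lambda>n. c * apply_bcontfun f n)"

lemma apply_scale_linfty [simp]:
  "apply_bcontfun (scale_linfty c f) n = c * apply_bcontfun f n"
proof -
  have "bounded ((\<lambda>y. c * y) ` range (apply_bcontfun f))"
    by (rule bounded_linear_image) (auto intro: bounded_linear_mult_right)
  then have "(\<lambda>n. c * apply_bcontfun f n) \<in> bcontfun"
    by (auto simp: bcontfun_def image_image intro!: continuous_intros)
  then show ?thesis
    by (simp add: scale_linfty_def Bcontfun_inverse)
qed

lemma vector_space_scale_linfty: "vector_space scale_linfty"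
  by unfold_locales (auto intro!: bcontfun_eqI simp: plus_bcontfun.rep_eq algebra_simps)

lemma scale_linfty_real: "scale_linfty r f = r *\<^sub>R f" for f :: "real linfty"
  by (rule bcontfun_eqI) (simp add: scaleR_bcontfun.rep_eq)

definition convergent_seqs :: "'k::real_normed_field linfty set" where
  "convergent_seqs = {f. convergent (apply_bcontfun f)}"

text \<open>
  There is no type class of complex Banach spaces. A complex Banach space is a type of class
  \<^class>\<open>banach\<close> (which supplies addition, the complete norm and the real scalar multiplication)
  with a complex scalar multiplication extending the real one and compatible with the norm.
\<close>

locale complex_banach = vector_space scaleC
  for scaleC :: "complex \<Rightarrow> 'a::banach \<Rightarrow> 'a" +
  assumes scaleC_of_real: "scaleC (complex_of_real r) x = r *\<^sub>R x"
    and norm_scaleC: "norm (scaleC c x) = cmod c * norm x"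

lemma complex_banach_mult: "complex_banach ((*) :: complex \<Rightarrow> complex \<Rightarrow> complex)"
  by unfold_locales (auto simp: algebra_simps norm_mult scaleR_conv_of_real)

definition isometric_to_subspace ::
    "('k::real_normed_field \<Rightarrow> 'a::real_normed_vector \<Rightarrow> 'a) \<Rightarrow> 'k linfty set \<Rightarrow> bool" where
  "isometric_to_subspace s Y \<longleftrightarrow>
     module.subspace scale_linfty Y \<and>
     (\<exists>T. Vector_Spaces.linear s scale_linfty T \<and> (\<forall>x. norm (T x) = norm x) \<and> range T = Y)"

end

(* Norming functionals g_k for a dense sequence d_k give an isometric embedding x |-> (g_k x)_k.
   List each g_k infinitely often, and the zero functional infinitely often as well: the image
   of x can then only converge if every g_k x vanishes, that is, if x = 0. *)
theory Submission
  imports Defs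
begin

section \<open>Norming functionals\<close>

text \<open>Negative values are allowed, so linear functionals are themselves sublinear and can be
  found as the minimal ones.\<close>

definition sublinear :: "('a::real_vector \<Rightarrow> real) \<Rightarrow> bool" where
  "sublinear p \<longleftrightarrow> (\<forall>x y. p (x + y) \<le> p x + p y) \<and> (\<forall>r x. 0 \<le> r \<longrightarrow> p (r *\<^sub>R x) = r * p x)"

lemma sublinear_add: "sublinear p \<Longrightarrow> p (x + y) \<le> p x + p y"
  and sublinear_scale: "sublinear p \<Longrightarrow> 0 \<le> r \<Longrightarrow> p (r *\<^sub>R x) = r * p x"
  by (auto simp: sublinear_def)

lemma sublinear_zero: "sublinear p \<Longrightarrow> p 0 = 0"
  using sublinear_scale[of p 0 0] by simp

lemma sublinear_minus_le: "sublinear p \<Longrightarrow> - p (- x) \<le> p x"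
  using sublinear_add[of p x "- x"] sublinear_zero[of p] by simp

lemma sublinear_norm: "sublinear norm"
  by (simp add: sublinear_def norm_triangle_ineq)

text \<open>The inequality for \<open>inverse r\<close> at \<open>r *\<^sub>R x\<close> is the
  reverse of the one for \<open>r\<close> at \<open>x\<close>, so one direction of homogeneity is
  enough.\<close>

lemma sublinearI:
  assumes "\<And>x y. p (x + y) \<le> p x + p y" and "p 0 = 0"
    and "\<And>r x. 0 < r \<Longrightarrow> p (r *\<^sub>R x) \<le> r * p x"
  shows "sublinear p"
  unfolding sublinear_def
proof (intro conjI allI impI)
  fix r :: real and x :: 'a
  assume "0 \<le> r"
  show "p (r *\<^sub>R x) = r * p x"
  proof (cases "r = 0")
    case False
    then have r: "0 < r" using \<open>0 \<le> r\<close> by simp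
    have "p (inverse r *\<^sub>R (r *\<^sub>R x)) \<le> inverse r * p (r *\<^sub>R x)"
      by (rule assms(3)) (use r in simp)
    then have "r * p x \<le> p (r *\<^sub>R x)"
      using r by (simp add: field_simps)
    then show ?thesis using assms(3)[OF r, of x] by simp
  qed (simp add: assms)
qed (rule assms)

text \<open>
  The functional \<open>q x = (INF t\<ge>0. p (x + t y) - t p y)\<close> is sublinear, lies below \<open>p\<close>, and is
  forced to be additive in the direction \<open>y\<close>.
\<close>

lemma sublinear_improve:
  fixes p :: "'a::real_vector \<Rightarrow> real"
  assumes p: "sublinear p"
  obtains q where "sublinear q" "\<And>x. q x \<le> p x" "\<And>x. q x \<le> p (x + y) - p y"
proof -
  define h where "h x t = p (x + t *\<^sub>R y) - t * p y" for x t
  define q where "q x = (INF t\<in>{0..}. h x t)" for x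
  \<comment> \<open>Subadditivity for \<open>t *\<^sub>R y = (x + t *\<^sub>R y) + (- x)\<close>.
    The bound does not depend on \<open>t\<close>, so the infimum defining \<open>q\<close> is
    finite.\<close>
  have lb: "- p (- x) \<le> h x t" if "0 \<le> t" for x t
    using sublinear_add[OF p, of "x + t *\<^sub>R y" "- x"] sublinear_scale[OF p that, of y]
    by (simp add: h_def)
  have bdd: "bdd_below (h x ` {0..})" for x
    by (rule bdd_belowI2[where m="- p (- x)"]) (simp add: lb)
  have le: "q x \<le> h x t" if "0 \<le> t" for x t
    unfolding q_def by (rule cINF_lower[OF bdd]) (use that in simp)
  have ge: "m \<le> q x" if "\<And>t. 0 \<le> t \<Longrightarrow> m \<le> h x t" for m x
    unfolding q_def by (rule cINF_greatest) (use that in auto)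
  have "sublinear q"
  proof (rule sublinearI)
    fix x z :: 'a
    \<comment> \<open>The parameters add up: \<open>h (x + z) (s + t) \<le> h x s + h z t\<close>.
      The infimum is taken first over \<open>t\<close>, then over \<open>s\<close>.\<close>
    have "q (x + z) - h x s \<le> q z" if s: "0 \<le> s" for s
    proof (rule ge)
      fix t :: real assume t: "0 \<le> t"
      have "q (x + z) \<le> h (x + z) (s + t)" by (rule le) (use s t in simp)
      also have "\<dots> \<le> h x s + h z t"
        using sublinear_add[OF p, of "x + s *\<^sub>R y" "z + t *\<^sub>R y"]
        by (simp add: h_def algebra_simps)
      finally show "q (x + z) - h x s \<le> h z t" by simp
    qed
    then have "q (x + z) - q z \<le> q x" by (intro ge) force
    then show "q (x + z) \<le> q x + q z" by simp
  next
    have "h 0 t = 0" if "0 \<le> t" for t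
      using sublinear_scale[OF p that, of y] by (simp add: h_def)
    then show "q 0 = 0" using le[of 0 0] ge[of 0 0] by force
  next
    fix r :: real and x :: 'a
    assume r: "0 < r"
    \<comment> \<open>Reparametrise by \<open>t \<mapsto> r * t\<close>, since
      \<open>h (r *\<^sub>R x) (r * t) = r * h x t\<close>.\<close>
    have "inverse r * q (r *\<^sub>R x) \<le> q x"
    proof (rule ge)
      fix t :: real assume t: "0 \<le> t"
      have "q (r *\<^sub>R x) \<le> h (r *\<^sub>R x) (r * t)" by (rule le) (use r t in simp)
      also have "\<dots> = r * h x t"
        using sublinear_scale[OF p, of r "x + t *\<^sub>R y"] r by (simp add: h_def algebra_simps)
      finally show "inverse r * q (r *\<^sub>R x) \<le> h x t" using r by (simp add: field_simps)
    qed
    then show "q (r *\<^sub>R x) \<le> r * q x" using r by (simp add: field_simps)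
  qed
  moreover have "q x \<le> p x" "q x \<le> p (x + y) - p y" for x
    using le[of 0 x] le[of 1 x] by (simp_all add: h_def)
  ultimately show ?thesis using that by blast
qed

text \<open>Subadditivity is where the chain matters: given \<open>q\<close> at \<open>x\<close> and
  \<open>r\<close> at \<open>y\<close>, the smaller of the two bounds the sum at both points. For
  general families the infimum can fail to be subadditive.\<close>

lemma sublinear_INF_chain:
  fixes C :: "('a::real_vector \<Rightarrow> real) set"
  assumes C: "C \<noteq> {}" "\<And>q. q \<in> C \<Longrightarrow> sublinear q"
    and bdd: "\<And>x. bdd_below ((\<lambda>q. q x) ` C)"
    and chain: "\<And>q r. q \<in> C \<Longrightarrow> r \<in> C \<Longrightarrow> q \<le> r \<or> r \<le> q"
  shows "sublinear (\<lambda>x. INF q\<in>C. q x)"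
proof (rule sublinearI)
  have le: "(INF q\<in>C. q x) \<le> q x" if "q \<in> C" for x q
    by (rule cINF_lower[OF bdd that])
  have ge: "m \<le> (INF q\<in>C. q x)" if "\<And>q. q \<in> C \<Longrightarrow> m \<le> q x" for m x
    by (rule cINF_greatest[OF C(1) that])
  {
    fix x y :: 'a
    have *: "(INF q\<in>C. q (x + y)) \<le> q x + r y" if q: "q \<in> C" and r: "r \<in> C" for q r
    proof -
      obtain s where s: "s \<in> C" "s \<le> q" "s \<le> r"
        using chain[OF q r] q r by blast
      have "(INF q\<in>C. q (x + y)) \<le> s x + s y"
        using le[OF s(1)] sublinear_add[OF C(2)[OF s(1)]] order_trans by blast
      also have "\<dots> \<le> q x + r y" using s(2,3) by (simp add: add_mono le_funD)
      finally show ?thesis .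
    qed
    have "(INF q\<in>C. q (x + y)) - q x \<le> (INF r\<in>C. r y)" if "q \<in> C" for q
      using *[OF that] by (intro ge) (simp add: algebra_simps)
    then have "(INF q\<in>C. q (x + y)) - (INF r\<in>C. r y) \<le> (INF q\<in>C. q x)"
      by (intro ge) force
    then show "(INF q\<in>C. q (x + y)) \<le> (INF q\<in>C. q x) + (INF q\<in>C. q y)"
      by simp
  }
  show "(INF q\<in>C. q 0) = 0"
    using C by (simp add: sublinear_zero cong: INF_cong)
  fix r :: real and x :: 'a
  assume r: "0 < r"
  have "inverse r * (INF q\<in>C. q (r *\<^sub>R x)) \<le> (INF q\<in>C. q x)"
  proof (rule ge)
    fix q assume q: "q \<in> C"
    then show "inverse r * (INF q\<in>C. q (r *\<^sub>R x)) \<le> q x"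
      using le[OF q, of "r *\<^sub>R x"] sublinear_scale[OF C(2)[OF q], of r x] r
      by (simp add: field_simps)
  qed
  then show "(INF q\<in>C. q (r *\<^sub>R x)) \<le> r * (INF q\<in>C. q x)"
    using r by (simp add: field_simps)
qed

lemma minimal_sublinear_le:
  fixes p :: "'a::real_vector \<Rightarrow> real"
  assumes p: "sublinear p"
  obtains f where "sublinear f" "f \<le> p" "\<And>q. sublinear q \<Longrightarrow> q \<le> f \<Longrightarrow> q = f"
proof -
  define A where "A = {q. sublinear q \<and> q \<le> p}"
  \<comment> \<open>The order is reversed, so the maximal element that Zorn's lemma yields is a
    minimal functional, and an upper bound of a chain is a pointwise lower bound.\<close>
  have po: "partial_order_on A (relation_of (\<lambda>q r. r \<le> q) A)"
    by (rule partial_order_on_relation_ofI) auto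
  have "\<exists>m\<in>A. \<forall>q\<in>A. m \<ge> q \<longrightarrow> q = m"
  proof (rule predicate_Zorn[OF po])
    fix C assume "C \<in> Chains (relation_of (\<lambda>q r. r \<le> q) A)"
    then have CA: "C \<subseteq> A" and chain: "\<And>q r. q \<in> C \<Longrightarrow> r \<in> C \<Longrightarrow> q \<le> r \<or> r \<le> q"
      by (auto simp: Chains_def relation_of_def)
    show "\<exists>u\<in>A. \<forall>q\<in>C. u \<le> q"
    proof (cases "C = {}")
      case True
      \<comment> \<open>The infimum over an empty chain is meaningless in the reals;
        \<open>p\<close> itself serves as the bound.\<close>
      then show ?thesis using p by (auto simp: A_def)
    next
      case False
      have bdd: "bdd_below ((\<lambda>q. q x) ` C)" for x
      proof (rule bdd_belowI2)
        fix q assume "q \<in> C"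
        then have "sublinear q" "q \<le> p" using CA by (auto simp: A_def)
        then show "- p (- x) \<le> q x"
          using sublinear_minus_le[of q x] le_funD[of q p "- x"] by simp
      qed
      define u where "u x = (INF q\<in>C. q x)" for x
      have le: "u \<le> q" if "q \<in> C" for q
        unfolding u_def by (intro le_funI cINF_lower[OF bdd that])
      obtain q where "q \<in> C" using False by blast
      then have "u \<le> p" using le[of q] CA by (auto simp: A_def)
      moreover have "sublinear u"
        unfolding u_def using False CA bdd chain
        by (intro sublinear_INF_chain) (auto simp: A_def)
      ultimately show ?thesis using le by (auto simp: A_def)
    qed
  qed
  \<comment> \<open>Minimality within \<open>A\<close> is minimality among all sublinear
    functionals, because anything below an element of \<open>A\<close> is also below
    \<open>p\<close>.\<close>
  then show ?thesis using that by (fastforce simp: A_def)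
qed

text \<open>The improvement of \<open>f\<close> in direction \<open>y\<close> lies below
  \<open>f\<close>, hence equals it by minimality. Its extra bound then reads
  \<open>f x \<le> f (x + y) - f y\<close>, the converse of subadditivity.\<close>

lemma linear_if_minimal_sublinear:
  fixes f :: "'a::real_vector \<Rightarrow> real"
  assumes f: "sublinear f" and min: "\<And>q. sublinear q \<Longrightarrow> q \<le> f \<Longrightarrow> q = f"
  shows "linear f"
proof -
  have add: "f (x + y) = f x + f y" for x y
  proof -
    obtain q where q: "sublinear q" "\<And>z. q z \<le> f z" "\<And>z. q z \<le> f (z + y) - f y"
      using sublinear_improve[OF f] by blast
    then have "q = f" by (intro min) (auto simp: le_fun_def)
    then show ?thesis using q(3)[of x] sublinear_add[OF f, of x y] by simp
  qed
  have neg: "f (- x) = - f x" for x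
    using add[of x "- x"] sublinear_zero[OF f] by simp
  show ?thesis
  proof (rule linearI)
    fix r x
    show "f (r *\<^sub>R x) = r *\<^sub>R f x"
    proof (cases "0 \<le> r")
      case False
      then show ?thesis
        using sublinear_scale[OF f, of "- r" x] neg[of "r *\<^sub>R x"] by simp
    qed (simp add: sublinear_scale[OF f])
  qed (rule add)
qed

text \<open>Instead of extending a functional from the line through \<open>a\<close>, the norm is
  first improved in direction \<open>a\<close>. Any linear \<open>f\<close> below the result has
  \<open>f (- a) \<le> norm (- a + a) - norm a = - norm a\<close>, which forces
  \<open>f a = norm a\<close>.\<close>

lemma norming_functional_real:
  fixes a :: "'a::real_normed_vector"
  obtains f :: "'a \<Rightarrow> real" where "linear f" "\<And>x. \<bar>f x\<bar> \<le> norm x" "f a = norm a"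
proof -
  obtain q :: "'a \<Rightarrow> real"
    where q: "sublinear q" "\<And>x. q x \<le> norm x" "\<And>x. q x \<le> norm (x + a) - norm a"
    using sublinear_improve[OF sublinear_norm] by blast
  obtain f where f: "sublinear f" "f \<le> q" "\<And>r. sublinear r \<Longrightarrow> r \<le> f \<Longrightarrow> r = f"
    using minimal_sublinear_le[OF q(1)] by blast
  have lin: "linear f" using f by (intro linear_if_minimal_sublinear)
  have le: "f x \<le> norm x" for x
    using le_funD[OF f(2)] q(2) order_trans by blast
  have "\<bar>f x\<bar> \<le> norm x" for x
    using le[of x] le[of "- x"] linear_neg[OF lin, of x] by simp
  moreover have "f a = norm a"
    using le[of a] le_funD[OF f(2), of "- a"] q(3)[of "- a"] linear_neg[OF lin, of a] by simp
  ultimately show ?thesis using lin that by blast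
qed

text \<open>The complex-linear functional with real part \<open>f\<close> is
  \<open>f x - \<i> * f (\<i> x)\<close>, where \<open>f\<close> is a real norming functional for
  \<open>a\<close>.\<close>

lemma (in complex_banach) norming_functional_complex:
  obtains g where "Vector_Spaces.linear scaleC ((*) :: complex \<Rightarrow> complex \<Rightarrow> complex) g"
    "\<And>x. cmod (g x) \<le> norm x" "norm a \<le> cmod (g a)"
proof -
  obtain f :: "'a \<Rightarrow> real"
    where f: "linear f" "\<And>x. \<bar>f x\<bar> \<le> norm x" "f a = norm a"
    using norming_functional_real by blast
  define g where "g x = Complex (f x) (- f (scaleC \<i> x))" for x
  have f_scale: "f (scaleC c x) = Re c * f x + Im c * f (scaleC \<i> x)" for c x
  proof -
    have "scaleC c x = scaleC (of_real (Re c) + of_real (Im c) * \<i>) x"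
      by (simp add: complex_eq_iff)
    also have "\<dots> = Re c *\<^sub>R x + Im c *\<^sub>R scaleC \<i> x"
      by (simp only: scale_left_distrib scaleC_of_real flip: scale_scale)
    finally show ?thesis by (simp add: linear_add[OF f(1)] linear_scale[OF f(1)])
  qed
  have g_add: "g (x + y) = g x + g y" for x y
    by (simp add: g_def scale_right_distrib linear_add[OF f(1)] complex_eq_iff)
  \<comment> \<open>The imaginary part of the left side is \<open>- f (scaleC (\<i> * c) x)\<close>,
    hence the second instance of \<open>f_scale\<close>.\<close>
  have g_scale: "g (scaleC c x) = c * g x" for c x
    using f_scale[of c x] f_scale[of "\<i> * c" x] by (simp add: g_def complex_eq_iff)
  have "Vector_Spaces.linear scaleC (*) g"
    unfolding Vector_Spaces.linear_iff
    using vector_space_axioms complex_banach_mult by (simp add: g_add g_scale complex_banach_def)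
  moreover have "cmod (g x) \<le> norm x" for x
  proof (cases "g x = 0")
    case False
    \<comment> \<open>The unimodular \<open>c\<close> rotates \<open>g x\<close> onto the positive
      real axis, where \<open>g\<close> is given by \<open>f\<close> and the real bound
      applies.\<close>
    define c where "c = cnj (sgn (g x))"
    have c: "cmod c = 1" using False by (simp add: c_def norm_sgn)
    have "c * g x = of_real (cmod (g x))"
      using False complex_norm_square[of "g x"]
      by (simp add: c_def sgn_eq field_simps power2_eq_square)
    then have "cmod (g x) = Re (g (scaleC c x))" by (simp add: g_scale)
    also have "\<dots> \<le> norm (scaleC c x)" using f(2)[of "scaleC c x"] by (simp add: g_def)
    finally show ?thesis by (simp add: norm_scaleC c)
  qed simp
  moreover have "norm a \<le> cmod (g a)"
    using complex_Re_le_cmod[of "g a"] f(3) by (simp add: g_def)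
  ultimately show ?thesis using that by blast
qed

section \<open>The embedding\<close>

text \<open>Along the positions \<open>prod_encode (i, j)\<close> with \<open>j\<close> growing, the
  sequence is constantly \<open>u i\<close>, so every \<open>u i\<close> is the limit.\<close>

lemma convergent_prod_decode_const:
  fixes u :: "nat \<Rightarrow> 'k::metric_space"
  assumes "convergent (\<lambda>n. u (fst (prod_decode n)))"
  shows "u i = u j"
proof -
  obtain L where L: "(\<lambda>n. u (fst (prod_decode n))) \<longlonglongrightarrow> L"
    using assms by (auto simp: convergent_def)
  have "u i = L" for i
  proof -
    have "filterlim (\<lambda>j. prod_encode (i, j)) at_top at_top"
      by (rule filterlim_at_top_mono[OF filterlim_ident]) (simp add: le_prod_encode_2)
    from filterlim_compose[OF L this] show ?thesis
      by (simp add: tendsto_const_iff)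
  qed
  then show ?thesis by simp
qed

text \<open>The scalar field is kept abstract: the real and the complex case differ only in how
  norming functionals are obtained.\<close>

lemma isometric_to_subspace_avoiding_convergent_seqs:
  fixes s :: "'k::real_normed_field \<Rightarrow> 'a::real_normed_vector \<Rightarrow> 'a"
  assumes s: "vector_space s"
    and sep: "separable_space (euclidean :: 'a topology)"
    and norming: "\<And>a. \<exists>g. Vector_Spaces.linear s ((*) :: 'k \<Rightarrow> 'k \<Rightarrow> 'k) g \<and>
      (\<forall>x. norm (g x) \<le> norm x) \<and> norm a \<le> norm (g a)"
  shows "\<exists>Y :: 'k linfty set. isometric_to_subspace s Y \<and> Y \<inter> convergent_seqs = {0}"
proof -
  obtain D :: "'a set" where D: "countable D" "closure D = UNIV"
    using sep by (auto simp: separable_space_def)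
  then have "D \<noteq> {}" by auto
  obtain g where lin: "\<And>a. Vector_Spaces.linear s (*) (g a)"
    and g_le: "\<And>a x. norm (g a x :: 'k) \<le> norm x" and g_ge: "\<And>a. norm a \<le> norm (g a a)"
    using norming by metis
  have g_add: "g a (x + y) = g a x + g a y" and g_scale: "g a (s c x) = c * g a x" for a c x y
    using lin[of a] by (simp_all add: Vector_Spaces.linear_iff)
  \<comment> \<open>The shift by one frees index 0 for the zero functional, which fixes the common
    value of a convergent image at 0.\<close>
  define G where "G i = (case i of 0 \<Rightarrow> (\<lambda>_. 0) | Suc k \<Rightarrow> g (from_nat_into D k))" for i
  have G_le: "norm (G i x) \<le> norm x" for i x
    by (simp add: G_def g_le split: nat.split)
  \<comment> \<open>The first component of the decoded position selects the functional; the second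
    only counts its repetitions.\<close>
  define T :: "'a \<Rightarrow> 'k linfty" where "T x = Bcontfun (\<lambda>n. G (fst (prod_decode n)) x)" for x
  have T: "apply_bcontfun (T x) n = G (fst (prod_decode n)) x" for x n
  proof -
    have "(\<lambda>n. G (fst (prod_decode n)) x) \<in> bcontfun"
      by (rule bcontfun_normI) (auto intro: G_le)
    then show ?thesis by (simp add: T_def Bcontfun_inverse)
  qed
  have linT: "Vector_Spaces.linear s scale_linfty T"
    unfolding Vector_Spaces.linear_iff
    by (auto intro!: bcontfun_eqI s vector_space_scale_linfty
      simp: T plus_bcontfun.rep_eq G_def g_add g_scale split: nat.split)
  have g_le_T: "norm (g d x) \<le> norm (T x)" if "d \<in> D" for d x
  proof -
    obtain k where "from_nat_into D k = d"
      using from_nat_into_surj[OF D(1), of d] \<open>d \<in> D\<close> by blast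
    then have "g d x = apply_bcontfun (T x) (prod_encode (Suc k, 0))"
      by (simp add: T G_def)
    then show ?thesis by (simp add: norm_bounded)
  qed
  have normT: "norm (T x) = norm x" for x
  proof (rule antisym)
    show "norm (T x) \<le> norm x" by (rule norm_bound) (simp add: T G_le)
    show "norm x \<le> norm (T x)"
    proof (rule field_le_epsilon)
      fix e :: real assume "0 < e"
      \<comment> \<open>Half of \<open>e\<close>, because the distance is paid twice: in passing
        from \<open>x\<close> to \<open>d\<close>, and in replacing \<open>g d d\<close> by
        \<open>g d x\<close>.\<close>
      then obtain d where d: "d \<in> D" "dist d x < e / 2"
        using D(2) by (metis UNIV_I closure_approachable half_gt_zero)
      have "norm d \<le> norm (g d x + g d (d - x))"
        using g_ge[of d] by (simp flip: g_add)
      also have "\<dots> \<le> norm (T x) + norm (d - x)"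
        by (intro norm_triangle_mono g_le_T[OF d(1)] g_le)
      finally show "norm x \<le> norm (T x) + e"
        using d(2) norm_triangle_ineq2[of x d] by (simp add: dist_norm norm_minus_commute)
    qed
  qed
  have "T x = 0" if "T x \<in> convergent_seqs" for x
  proof (rule bcontfun_eqI)
    fix n
    have "convergent (\<lambda>n. G (fst (prod_decode n)) x)"
      using that by (simp add: convergent_seqs_def T[abs_def])
    \<comment> \<open>Since \<open>G 0 x = 0\<close>, every coordinate of \<open>T x\<close>
      vanishes.\<close>
    then have "G i x = G 0 x" for i by (rule convergent_prod_decode_const)
    then show "apply_bcontfun (T x) n = apply_bcontfun 0 n"
      by (simp add: T G_def zero_bcontfun.rep_eq)
  qed
  moreover have "T 0 = 0" using normT[of 0] by simp
  moreover have "0 \<in> (convergent_seqs :: 'k linfty set)"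
    by (simp add: convergent_seqs_def zero_bcontfun.rep_eq convergent_const)
  ultimately have "range T \<inter> convergent_seqs = {0}"
    by (auto intro: range_eqI[of _ _ 0])
  moreover have "module.subspace scale_linfty (range T)"
  proof -
    interpret T: Vector_Spaces.linear s scale_linfty T by (rule linT)
    show ?thesis by (rule T.subspace_image[OF T.vs1.subspace_UNIV])
  qed
  ultimately show ?thesis
    unfolding isometric_to_subspace_def using linT normT by blast
qed

theorem theorem2p1:
  fixes scaleC :: "complex \<Rightarrow> 'b::banach \<Rightarrow> 'b"
  shows
    "(separable_space (euclidean :: 'a::banach topology) \<longrightarrow>
        (\<exists>Y :: real linfty set.
           isometric_to_subspace (scaleR :: real \<Rightarrow> 'a \<Rightarrow> 'a) Y \<and> Y \<inter> convergent_seqs = {0})) \<and>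
     (complex_banach scaleC \<and> separable_space (euclidean :: 'b topology) \<longrightarrow>
        (\<exists>Y :: complex linfty set.
           isometric_to_subspace scaleC Y \<and> Y \<inter> convergent_seqs = {0}))"
proof (intro conjI impI)
  assume sep: "separable_space (euclidean :: 'a topology)"
  show "\<exists>Y :: real linfty set.
    isometric_to_subspace (scaleR :: real \<Rightarrow> 'a \<Rightarrow> 'a) Y \<and> Y \<inter> convergent_seqs = {0}"
  proof (rule isometric_to_subspace_avoiding_convergent_seqs[OF _ sep])
    show "vector_space (scaleR :: real \<Rightarrow> 'a \<Rightarrow> 'a)" by unfold_locales
    fix a :: 'a
    obtain f :: "'a \<Rightarrow> real" where "linear f" "\<And>x. \<bar>f x\<bar> \<le> norm x" "f a = norm a"
      using norming_functional_real by blast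
    \<comment> \<open>This turns \<open>linear f\<close>, which is stated with \<open>scaleR\<close>
      on both sides, into linearity over the field multiplication.\<close>
    moreover have "(scaleR :: real \<Rightarrow> real \<Rightarrow> real) = (*)" by (simp add: fun_eq_iff)
    ultimately show "\<exists>g. Vector_Spaces.linear scaleR ((*) :: real \<Rightarrow> real \<Rightarrow> real) g \<and>
        (\<forall>x. norm (g x) \<le> norm x) \<and> norm a \<le> norm (g a)"
      by (intro exI[of _ f]) (simp add: linear_def)
  qed
next
  assume "complex_banach scaleC \<and> separable_space (euclidean :: 'b topology)"
  then have sep: "separable_space (euclidean :: 'b topology)" and "complex_banach scaleC"
    by simp_all
  then interpret complex_banach scaleC by simp
  show "\<exists>Y :: complex linfty set. isometric_to_subspace scaleC Y \<and> Y \<inter> convergent_seqs = {0}"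
    using norming_functional_complex
    by (intro isometric_to_subspace_avoiding_convergent_seqs[OF vector_space_axioms sep]) metis
qed

end
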